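(* Let $y\ge1$ be an integer and let $k\ge0$ be the integer with $2^k\le y<2^{k+1}$. (i) The set $\mathrm{Ulam}[y]$ is biperiodic if and only if $y$ is not a Zumkeller number, and in this case it has a biperiod of $2^{k+1}\times2^{k+1}$. (ii) If $y$ is a Zumkeller number, then $\mathrm{Ulam}[y]$ is eventually biperiodic with a biperiod of $2^{k+1}\times2^{k+1}$; moreover, the only aperiodicities (called "impurities") occur in the bottom-left block $\{(x,z): x,z<2^{k+1}\}$. That is, there is a set $P\subset\mathbb{N}^2$ that is biperiodic with biperiod $2^{k+1}\times2^{k+1}$ such that every point $(x,z)$ lying in exactly one of $\mathrm{Ulam}[y]$ and $P$ satisfies $x,z<2^{k+1}$.
   Context: $\mathbb{N}=\{0,1,2,\dots\}$. Ulam words are binary words defined recursively: $\mathcal{U}(1)=\{0,1\}$, and for $n>1$, $\mathcal{U}(n)$ is the set of all words of length $n$ over $\{0,1\}$ that are expressible uniquely as a concatenation $uv$ of two distinct words $u\in\mathcal{U}(i)$, $v\in\mathcal{U}(j)$ with $i,j<n$ (i.e. there is exactly one ordered pair $(u,v)$ of such words, $u\ne v$). A word is Ulam if it belongs to $\bigcup_{n\ge1}\mathcal{U}(n)$. $0^m$ denotes a block of $m$ zeros. $\mathrm{Ulam}[y]\subset\mathbb{N}^2$ is the set of $(x,z)$ such that the word $0^x10^y10^z$ is Ulam. A positive integer is a Zumkeller number if it has at most one $0$ in its binary representation. A set $A\subset\mathbb{N}^2$ is biperiodic with biperiod $p\times q$ ($p,q$ positive integers) if for all $x,z\in\mathbb{N}$: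 $(x,z)\in A\iff(x+p,z)\in A\iff(x,z+q)\in A$. It is biperiodic if it is so for some positive integers $p,q$. A biperiod need not be minimal. *)

theory Defs
  imports Main
begin

text \<open>
  Binary words are Boolean lists, with \<^term>\<open>False\<close> for the letter 0 and
  \<^term>\<open>True\<close> for the letter 1.  Lengths start at 1, so level 0 is empty.
\<close>

function Ulam_level :: "nat \<Rightarrow> bool list set" where
  "Ulam_level n =
    (if n = 0 then {}
     else if n = 1 then {[False], [True]}
     else {w. length w = n \<and>
              (\<exists>!(u, v). (\<exists>i\<in>{1..<n}. u \<in> Ulam_level i) \<and>
                         (\<exists>j\<in>{1..<n}. v \<in> Ulam_level j) \<and>
                         u \<noteq> v \<and> w = u @ v)})"
  by pat_completeness auto
termination
  by (relation "measure id") auto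

text \<open>The defining equation would loop as a simplification rule.\<close>

declare Ulam_level.simps [simp del]

definition is_Ulam :: "bool list \<Rightarrow> bool" where
  "is_Ulam w \<longleftrightarrow> (\<exists>n\<ge>1. w \<in> Ulam_level n)"

definition Ulam :: "nat \<Rightarrow> (nat \<times> nat) set" where
  "Ulam y = {(x, z). is_Ulam (replicate x False @ [True] @ replicate y False @
                              [True] @ replicate z False)}"

text \<open>
  The positions of the binary representation of \<^term>\<open>y\<close> (without leading
  zeros) are the \<^term>\<open>i\<close> with \<^prop>\<open>2 ^ i \<le> y\<close>.
\<close>

definition zumkeller :: "nat \<Rightarrow> bool" where
  "zumkeller y \<longleftrightarrow> 0 < y \<and> card {i. 2 ^ i \<le> y \<and> \<not> bit y i} \<le> 1"

definition has_biperiod :: "(nat \<times> nat) set \<Rightarrow> nat \<Rightarrow> nat \<Rightarrow> bool" where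
  "has_biperiod A p q \<longleftrightarrow> 0 < p \<and> 0 < q \<and>
     (\<forall>x z. ((x, z) \<in> A \<longleftrightarrow> (x + p, z) \<in> A) \<and>
            ((x, z) \<in> A \<longleftrightarrow> (x, z + q) \<in> A))"

definition biperiodic :: "(nat \<times> nat) set \<Rightarrow> bool" where
  "biperiodic A \<longleftrightarrow> (\<exists>p q. has_biperiod A p q)"

end

theory Submission
  imports Defs
begin

text \<open>
  A split of \<open>0^x 1 0^y 1 0^z\<close> into two Ulam words either cuts off one outer zero or cuts between the
  ones.  A word \<open>0^a 1 0^b\<close> is Ulam iff \<open>a AND b = 0\<close>, so membership of \<open>(x, z)\<close> is decided by the
  left and lower neighbours together with the number of \<open>i \<le> y\<close> with \<open>i AND x = 0\<close> and
  \<open>(y - i) AND z = 0\<close>.  This number \<open>T x z\<close> depends only on \<open>x\<close> and \<open>z\<close> modulo \<open>N = 2 ^ (k + 1)\<close>.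
  It has to be lowered by 1 where \<open>x + z = y\<close> and \<open>x AND z = 0\<close>, because there one
  split has two equal halves.

  At the start of each period \<open>T\<close> is at least 2, which blocks any influence of the
  preceding period, except at the last cell of that line, whose neighbour is a corner
  \<open>(N - 1, N - 1)\<close>.  There \<open>T\<close> vanishes, and by symmetry the two neighbours cancel, so the
  corner is not Ulam and the pattern determined by \<open>T\<close> is periodic.  The correction is confined
  to the block \<open>x, z < N\<close>.  If \<open>y\<close> has two zero bits, then \<open>T \<ge> 3\<close> at the corrected cells, so that
  the correction is invisible.  If it has at most one, then \<open>T\<close> is 1 or 2 at \<open>(0, y)\<close> and the correction
  changes that cell.
\<close>

unbundle bit_operations_syntax

section \<open>Splits of Ulam words\<close>

lemma length_Ulam_level: "w \<in> Ulam_level n \<Longrightarrow> length w = n"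
  by (subst (asm) Ulam_level.simps) (auto split: if_splits)

lemma is_Ulam_iff_level: "is_Ulam w \<longleftrightarrow> w \<noteq> [] \<and> w \<in> Ulam_level (length w)"
  unfolding is_Ulam_def using length_Ulam_level
  by (metis One_nat_def Suc_leI length_greater_0_conv less_eq_Suc_le list.size(3) not_one_le_zero)

lemma is_Ulam_singleton: "is_Ulam [b]"
  by (subst is_Ulam_iff_level, subst Ulam_level.simps) auto

lemma level_below_iff: "(\<exists>i\<in>{1..<n}. u \<in> Ulam_level i) \<longleftrightarrow> is_Ulam u \<and> length u < n"
proof
  assume "\<exists>i\<in>{1..<n}. u \<in> Ulam_level i"
  then obtain i where "i \<in> {1..<n}" "u \<in> Ulam_level i" by blast
  then show "is_Ulam u \<and> length u < n"
    using length_Ulam_level[of u i] by (auto simp: is_Ulam_def)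
next
  assume "is_Ulam u \<and> length u < n"
  then show "\<exists>i\<in>{1..<n}. u \<in> Ulam_level i"
    by (intro bexI[of _ "length u"]) (auto simp: is_Ulam_iff_level Suc_leI)
qed

text \<open>Cut positions replace pairs of words, so unique existence becomes a cardinality. The
  cuts at both ends are harmless because the empty word is not Ulam.\<close>

definition Ulam_splits :: "bool list \<Rightarrow> nat set" where
  "Ulam_splits w = {n. n \<le> length w \<and> is_Ulam (take n w) \<and> is_Ulam (drop n w) \<and> take n w \<noteq> drop n w}"

lemma is_Ulam_iff_card_splits:
  assumes "2 \<le> length w"
  shows "is_Ulam w \<longleftrightarrow> card (Ulam_splits w) = 1"
proof -
  define Q where "Q = (\<lambda>(u, v). is_Ulam u \<and> is_Ulam v \<and> u \<noteq> v \<and> w = u @ v)"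
  have Q: "(\<lambda>(u, v). (\<exists>i\<in>{1..<length w}. u \<in> Ulam_level i) \<and>
             (\<exists>j\<in>{1..<length w}. v \<in> Ulam_level j) \<and> u \<noteq> v \<and> w = u @ v) = Q"
    unfolding level_below_iff Q_def by (auto simp: is_Ulam_iff_level)
  have nz: "length w \<noteq> 0" "length w \<noteq> 1" "w \<noteq> []" using assms by auto
  have "bij_betw (\<lambda>n. (take n w, drop n w)) (Ulam_splits w) (Collect Q)"
    by (rule bij_betw_byWitness[where f' = "\<lambda>(u, v). length u"]) (auto simp: Ulam_splits_def Q_def)
  then have card: "card (Collect Q) = card (Ulam_splits w)"
    by (simp add: bij_betw_same_card)
  have "is_Ulam w \<longleftrightarrow> w \<in> Ulam_level (length w)"
    using nz is_Ulam_iff_level by blast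
  also have "\<dots> \<longleftrightarrow> (\<exists>!p. Q p)"
    by (subst Ulam_level.simps) (simp only: nz if_False mem_Collect_eq simp_thms Q)
  also have "\<dots> \<longleftrightarrow> card (Collect Q) = 1"
    unfolding One_nat_def card_1_singleton_iff by (auto simp: set_eq_iff)
  finally show ?thesis by (simp only: card)
qed

text \<open>For \<open>m >= 2\<close>, induction forces both halves to be the single zero; then they
  are equal, which is forbidden.\<close>

lemma is_Ulam_zeros: "is_Ulam (replicate m False) \<longleftrightarrow> m = 1"
proof (induction m rule: less_induct)
  case (less m)
  consider "m = 0" | "m = 1" | "2 \<le> m" by linarith
  then show ?case
  proof cases
    case 3
    have "n \<notin> Ulam_splits (replicate m False)" for n
      using less[of n] less[of "m - n"] 3
      by (cases "n = 0"; cases "n = m") (auto simp: Ulam_splits_def is_Ulam_iff_level[of "[]"])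
    then have "Ulam_splits (replicate m False) = {}" by blast
    then show ?thesis using 3 is_Ulam_iff_card_splits[of "replicate m False"] by simp
  qed (auto simp: is_Ulam_singleton is_Ulam_iff_level[of "[]"])
qed

section \<open>Words with a single one\<close>

definition one_word :: "nat \<Rightarrow> nat \<Rightarrow> bool list" where
  "one_word a b = replicate a False @ True # replicate b False"

definition two_word :: "nat \<Rightarrow> nat \<Rightarrow> nat \<Rightarrow> bool list" where
  "two_word y x z = replicate x False @ True # replicate y False @ True # replicate z False"

lemma one_word_eq_iff: "one_word a b = one_word c d \<longleftrightarrow> a = c \<and> b = d"
proof
  assume eq: "one_word a b = one_word c d"
  have "length (takeWhile (\<lambda>t. \<not> t) (one_word p q)) = p" for p q
    by (induction p) (simp_all add: one_word_def)
  moreover have "length (one_word p q) = p + q + 1" for p q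
    by (simp add: one_word_def)
  ultimately show "a = c \<and> b = d"
    using eq by (metis add_left_cancel add_right_cancel)
qed simp

lemma True_in_one_word: "True \<in> set (one_word a b)"
  by (simp add: one_word_def)

lemma True_in_two_word: "True \<in> set (two_word y x z)"
  by (simp add: two_word_def)

text \<open>One half contains no one, so it must be the single letter 0, cut off at the left or
  right end.\<close>

lemma one_split_iff:
  "n \<in> Ulam_splits (one_word a b) \<longleftrightarrow>
     n = 1 \<and> a > 0 \<and> is_Ulam (one_word (a - 1) b) \<or>
     n = a + b \<and> b > 0 \<and> is_Ulam (one_word a (b - 1))"
  (is "_ \<longleftrightarrow> ?R")
proof -
  have zo: "replicate m False \<noteq> one_word c d" "one_word c d \<noteq> replicate m False" for m c d
    using True_in_one_word[of c d] by (metis in_set_replicate)+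
  consider "n \<le> a" | "a < n" "n \<le> a + b + 1" | "a + b + 1 < n" by linarith
  then show ?thesis
  proof cases
    case 1
    then have "take n (one_word a b) = replicate n False" "drop n (one_word a b) = one_word (a - n) b"
      by (auto simp: one_word_def)
    with 1 show ?thesis
      by (auto simp: Ulam_splits_def is_Ulam_zeros zo) (auto simp: one_word_def)
  next
    case 2
    define m where "m = n - (a + 1)"
    with 2 have m: "n = a + 1 + m" "m \<le> b" by auto
    then have "take n (one_word a b) = one_word a m" "drop n (one_word a b) = replicate (b - m) False"
      by (auto simp: one_word_def)
    moreover have "n \<le> length (one_word a b)"
      using m by (simp add: one_word_def)
    ultimately have "n \<in> Ulam_splits (one_word a b) \<longleftrightarrow> is_Ulam (one_word a m) \<and> b - m = 1"
      by (simp add: Ulam_splits_def is_Ulam_zeros zo)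
    moreover have "b - m = 1 \<longleftrightarrow> n = a + b" "n = a + b \<Longrightarrow> m = b - 1 \<and> b > 0" "\<not> (n = 1 \<and> a > 0)"
      using m by auto
    ultimately show ?thesis
      by metis
  next
    case 3
    then show ?thesis by (auto simp: Ulam_splits_def one_word_def)
  qed
qed

lemma is_Ulam_one_word_rec:
  assumes "0 < a + b"
  shows "is_Ulam (one_word a b) \<longleftrightarrow>
    (a > 0 \<and> is_Ulam (one_word (a - 1) b)) \<noteq> (b > 0 \<and> is_Ulam (one_word a (b - 1)))"
    (is "_ \<longleftrightarrow> ?L \<noteq> ?R")
proof -
  have "2 \<le> length (one_word a b)"
    using assms by (auto simp: one_word_def Suc_le_eq)
  moreover have "Ulam_splits (one_word a b) = (if ?L then {1} else {}) \<union> (if ?R then {a + b} else {})"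
    by (rule set_eqI) (subst one_split_iff, simp)
  moreover have "card ((if ?L then {1} else {}) \<union> (if ?R then {a + b} else {})) = 1 \<longleftrightarrow> ?L \<noteq> ?R"
  proof (cases "?L \<and> ?R")
    case True
    \<comment> \<open>The two cuts would coincide only for \<open>a + b = 1\<close>, but here
      \<open>a\<close> and \<open>b\<close> are both positive.\<close>
    then have "1 \<noteq> a + b" by linarith
    with True show ?thesis by simp
  qed auto
  ultimately show ?thesis
    using is_Ulam_iff_card_splits by simp
qed

lemma and_eq_0_double:
  fixes a b :: nat
  shows "(2 * a) AND (2 * b) = 0 \<longleftrightarrow> a AND b = 0"
    "Suc (2 * a) AND (2 * b) = 0 \<longleftrightarrow> a AND b = 0"
    "(2 * a) AND Suc (2 * b) = 0 \<longleftrightarrow> a AND b = 0"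
    "Suc (2 * a) AND Suc (2 * b) \<noteq> 0"
  by (simp_all add: and_rec[of "2 * a" "2 * b"] and_rec[of "Suc (2 * a)" "2 * b"]
      and_rec[of "2 * a" "Suc (2 * b)"] and_rec[of "Suc (2 * a)" "Suc (2 * b)"])

text \<open>Pascal's rule modulo 2: by Lucas, \<open>a AND b = 0\<close> says that \<open>(a + b) choose a\<close> is odd.\<close>

lemma and_eq_0_pascal:
  fixes a b :: nat
  assumes "0 < a + b"
  shows "a AND b = 0 \<longleftrightarrow> (a > 0 \<and> (a - 1) AND b = 0) \<noteq> (b > 0 \<and> a AND (b - 1) = 0)"
  using assms
proof (induction "a + b" arbitrary: a b rule: less_induct)
  case less
  \<comment> \<open>Only the even-even case needs the induction hypothesis. In each mixed case a
    shared last bit kills one summand; in the odd-odd case it kills the left side, and the two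
    summands agree.\<close>
  consider (ee) c d where "a = 2 * c" "b = 2 * d" | (eo) c d where "a = 2 * c" "b = Suc (2 * d)"
    | (oe) c d where "a = Suc (2 * c)" "b = 2 * d" | (oo) c d where "a = Suc (2 * c)" "b = Suc (2 * d)"
    by (metis evenE oddE Suc_eq_plus1)
  then show ?case
  proof cases
    case ee
    have "(a - 1) AND b = 0 \<longleftrightarrow> (c - 1) AND d = 0" if "c > 0"
    proof -
      have "a - 1 = Suc (2 * (c - 1))" using that ee by simp
      then show ?thesis by (simp only: ee(2) and_eq_0_double)
    qed
    moreover have "a AND (b - 1) = 0 \<longleftrightarrow> c AND (d - 1) = 0" if "d > 0"
    proof -
      have "b - 1 = Suc (2 * (d - 1))" using that ee by simp
      then show ?thesis by (simp only: ee(1) and_eq_0_double)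
    qed
    moreover have "a AND b = 0 \<longleftrightarrow> c AND d = 0" "a > 0 \<longleftrightarrow> c > 0" "b > 0 \<longleftrightarrow> d > 0"
      by (simp_all add: ee and_eq_0_double)
    moreover have "c AND d = 0 \<longleftrightarrow> (c > 0 \<and> (c - 1) AND d = 0) \<noteq> (d > 0 \<and> c AND (d - 1) = 0)"
      using less.prems ee by (intro less.hyps) auto
    ultimately show ?thesis by metis
  next
    case eo
    have "(a - 1) AND b \<noteq> 0" if "c > 0"
    proof -
      have "a - 1 = Suc (2 * (c - 1))" using that eo by simp
      then show ?thesis by (simp only: eo(2) and_eq_0_double simp_thms)
    qed
    moreover have "a AND b = 0 \<longleftrightarrow> c AND d = 0" "a AND (b - 1) = 0 \<longleftrightarrow> c AND d = 0" "a > 0 \<longleftrightarrow> c > 0" "b > 0"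
      by (simp_all add: eo and_eq_0_double)
    ultimately show ?thesis by metis
  next
    case oe
    have "a AND (b - 1) \<noteq> 0" if "d > 0"
    proof -
      have "b - 1 = Suc (2 * (d - 1))" using that oe by simp
      then show ?thesis by (simp only: oe(1) and_eq_0_double simp_thms)
    qed
    moreover have "a AND b = 0 \<longleftrightarrow> c AND d = 0" "(a - 1) AND b = 0 \<longleftrightarrow> c AND d = 0" "b > 0 \<longleftrightarrow> d > 0" "a > 0"
      by (simp_all add: oe and_eq_0_double)
    ultimately show ?thesis by metis
  next
    case oo
    have "a AND b \<noteq> 0" "(a - 1) AND b = 0 \<longleftrightarrow> c AND d = 0" "a AND (b - 1) = 0 \<longleftrightarrow> c AND d = 0" "a > 0" "b > 0"
      by (simp_all only: oo and_eq_0_double diff_Suc_1 zero_less_Suc simp_thms)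
    then show ?thesis by metis
  qed
qed

lemma is_Ulam_one_word: "is_Ulam (one_word a b) \<longleftrightarrow> a AND b = 0"
proof (induction "a + b" arbitrary: a b rule: less_induct)
  case less
  show ?case
  proof (cases "a + b = 0")
    case True
    then show ?thesis by (simp add: one_word_def is_Ulam_singleton)
  next
    case False
    then show ?thesis
      using less[of "a - 1" b] less[of a "b - 1"]
      by (subst is_Ulam_one_word_rec, simp, subst and_eq_0_pascal, simp) (intro arg_cong2[where f = "(\<noteq>)"] conj_cong refl; simp)
  qed
qed

section \<open>The recursion for words with two ones\<close>

text \<open>Here \<open>i\<close> of the \<open>y\<close> middle zeros go to the left half. The last
  condition excludes the equal halves \<open>one_word x i\<close> and
  \<open>one_word (y - i) z\<close>.\<close>

definition inner_splits :: "nat \<Rightarrow> nat \<Rightarrow> nat \<Rightarrow> nat set" where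
  "inner_splits y x z = {i. i \<le> y \<and> i AND x = 0 \<and> (y - i) AND z = 0 \<and> \<not> (x = y - i \<and> i = z)}"

lemma two_split_iff:
  "n \<in> Ulam_splits (two_word y x z) \<longleftrightarrow>
     n = 1 \<and> x > 0 \<and> is_Ulam (two_word y (x - 1) z) \<or>
     n = x + y + z + 1 \<and> z > 0 \<and> is_Ulam (two_word y x (z - 1)) \<or>
     n \<in> (\<lambda>i. x + 1 + i) ` inner_splits y x z"
proof -
  have zo: "replicate m False \<noteq> two_word y c d" "two_word y c d \<noteq> replicate m False" for m c d
    using True_in_two_word[of y c d] by (metis in_set_replicate)+
  consider "n \<le> x" | "x < n" "n \<le> x + y + 1" | "x + y + 1 < n" "n \<le> x + y + z + 2" | "x + y + z + 2 < n"
    by linarith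
  then show ?thesis
  proof cases
    case 1
    then have "take n (two_word y x z) = replicate n False" "drop n (two_word y x z) = two_word y (x - n) z"
      by (auto simp: two_word_def)
    with 1 show ?thesis
      by (auto simp: Ulam_splits_def is_Ulam_zeros zo) (auto simp: two_word_def)
  next
    case 2
    define i where "i = n - (x + 1)"
    with 2 have i: "n = x + 1 + i" "i \<le> y" by auto
    then have "take n (two_word y x z) = one_word x i" "drop n (two_word y x z) = one_word (y - i) z"
      by (auto simp: two_word_def one_word_def)
    moreover have "n \<le> length (two_word y x z)"
      using i by (simp add: two_word_def)
    ultimately show ?thesis
      using i by (auto simp: Ulam_splits_def is_Ulam_one_word one_word_eq_iff inner_splits_def and.commute)
  next
    case 3
    define m where "m = n - (x + y + 2)"
    with 3 have m: "n = x + y + 2 + m" "m \<le> z" by auto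
    then have "take n (two_word y x z) = two_word y x m" "drop n (two_word y x z) = replicate (z - m) False"
      by (auto simp: two_word_def)
    moreover have "n \<le> length (two_word y x z)"
      using m by (simp add: two_word_def)
    ultimately have "n \<in> Ulam_splits (two_word y x z) \<longleftrightarrow> is_Ulam (two_word y x m) \<and> z - m = 1"
      by (simp add: Ulam_splits_def is_Ulam_zeros zo)
    moreover have "z - m = 1 \<longleftrightarrow> n = x + y + z + 1" "n = x + y + z + 1 \<Longrightarrow> m = z - 1 \<and> z > 0"
      "\<not> (n = 1 \<and> x > 0)" "n \<notin> (\<lambda>i. x + 1 + i) ` inner_splits y x z"
      using m by (auto simp: inner_splits_def)
    ultimately show ?thesis
      by metis
  next
    case 4
    then show ?thesis by (auto simp: Ulam_splits_def two_word_def inner_splits_def)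
  qed
qed

lemma finite_inner_splits [simp]: "finite (inner_splits y x z)"
  unfolding inner_splits_def by (rule finite_subset[of _ "{..y}"]) auto

text \<open>The summands count the splits that cut off a leading zero, a trailing zero, or separate the ones.\<close>

fun grid :: "(nat \<Rightarrow> nat \<Rightarrow> nat) \<Rightarrow> nat \<Rightarrow> nat \<Rightarrow> bool" where
  "grid f x z \<longleftrightarrow>
     (if x = 0 then 0 else of_bool (grid f (x - 1) z)) +
     (if z = 0 then 0 else of_bool (grid f x (z - 1))) + f x z = (1 :: nat)"

declare grid.simps [simp del]

lemma is_Ulam_two_word: "is_Ulam (two_word y x z) \<longleftrightarrow> grid (\<lambda>x z. card (inner_splits y x z)) x z"
proof (induction "x + z" arbitrary: x z rule: less_induct)
  case less
  let ?A = "if x > 0 \<and> is_Ulam (two_word y (x - 1) z) then {1 :: nat} else {}"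
  let ?B = "if z > 0 \<and> is_Ulam (two_word y x (z - 1)) then {x + y + z + 1} else {}"
  let ?C = "(\<lambda>i. x + 1 + i) ` inner_splits y x z"
  have "Ulam_splits (two_word y x z) = ?A \<union> (?B \<union> ?C)"
    by (rule set_eqI) (subst two_split_iff, simp)
  moreover have "card (?A \<union> (?B \<union> ?C)) = card ?A + card (?B \<union> ?C)"
    by (rule card_Un_disjoint) (auto simp: inner_splits_def)
  moreover have "card (?B \<union> ?C) = card ?B + card ?C"
    by (rule card_Un_disjoint) (auto simp: inner_splits_def)
  moreover have "card ?C = card (inner_splits y x z)"
    by (rule card_image) (auto simp: inj_on_def)
  moreover have "card ?A = (if x = 0 then 0 else of_bool (is_Ulam (two_word y (x - 1) z)))"
    "card ?B = (if z = 0 then 0 else of_bool (is_Ulam (two_word y x (z - 1))))"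
    by auto
  moreover have "2 \<le> length (two_word y x z)"
    by (simp add: two_word_def)
  ultimately have "is_Ulam (two_word y x z) \<longleftrightarrow>
      (if x = 0 then 0 else of_bool (is_Ulam (two_word y (x - 1) z))) +
      (if z = 0 then 0 else of_bool (is_Ulam (two_word y x (z - 1)))) + card (inner_splits y x z) = (1 :: nat)"
    using is_Ulam_iff_card_splits by (simp only: add.assoc)
  also have "\<dots> \<longleftrightarrow> grid (\<lambda>x z. card (inner_splits y x z)) x z"
    by (subst grid.simps) (use less[of "x - 1" z] less[of x "z - 1"] in \<open>cases "x = 0"; cases "z = 0"; simp\<close>)
  finally show ?case .
qed

section \<open>Symmetry and periodicity of the recursion\<close>

lemma grid_commute:
  assumes "\<And>x z. f x z = f z x"
  shows "grid f x z = grid f z x"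
proof (induction "x + z" arbitrary: x z rule: less_induct)
  case less
  then show ?case
    using assms[of x z] less[of "x - 1" z] less[of x "z - 1"]
    by (subst grid.simps, subst (2) grid.simps) (cases "x = 0"; cases "z = 0"; simp add: add.commute)
qed

text \<open>On the diagonal the two neighbours agree by symmetry and cancel.\<close>

lemma not_grid_diagonal:
  assumes "\<And>x z. f x z = f z x" and "f x x = 0"
  shows "\<not> grid f x x"
  using assms(2) grid_commute[of f "x - 1" x, OF assms(1)]
  by (subst grid.simps) simp

lemma not_grid_if_ge_2: "2 \<le> f x z \<Longrightarrow> \<not> grid f x z"
  by (subst grid.simps) simp

text \<open>A source of at least 2 excludes the cell whatever its neighbours are, so its exact value
  is irrelevant.\<close>

lemma grid_cong:
  assumes "\<And>x z. f x z = g x z \<or> 2 \<le> f x z \<and> 2 \<le> g x z"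
  shows "grid f x z = grid g x z"
proof (induction "x + z" arbitrary: x z rule: less_induct)
  case less
  show ?case
  proof (cases "2 \<le> f x z \<and> 2 \<le> g x z")
    case True
    then show ?thesis using not_grid_if_ge_2[of f] not_grid_if_ge_2[of g] by blast
  next
    case False
    then have "f x z = g x z" using assms by blast
    then show ?thesis
      using less[of "x - 1" z] less[of x "z - 1"]
      by (subst grid.simps, subst (2) grid.simps) (cases "x = 0"; cases "z = 0"; simp)
  qed
qed

text \<open>
  On the lines \<open>x mod N = 0\<close> and \<open>z mod N = 0\<close> the source is at least 2 except at the last cell,
  so the only cell of one period that could influence the next one is the corner \<open>(N - 1, N - 1)\<close>.
\<close>

lemma grid_mod:
  fixes f g :: "nat \<Rightarrow> nat \<Rightarrow> nat"
  assumes N: "2 \<le> N"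
    and fg: "\<And>x z. N \<le> x \<or> N \<le> z \<Longrightarrow> f x z = g (x mod N) (z mod N)"
    and corner_f: "\<not> grid f (N - 1) (N - 1)" and corner_g: "\<not> grid g (N - 1) (N - 1)"
    and sym: "\<And>x z. g x z = g z x"
    and edge: "\<And>z. z < N - 1 \<Longrightarrow> 2 \<le> g 0 z" and edge_end: "g 0 (N - 1) = 1"
  shows "N \<le> x \<or> N \<le> z \<Longrightarrow> grid f x z = grid g (x mod N) (z mod N)"
proof (induction "x + z" arbitrary: x z rule: less_induct)
  case less
  let ?X = "x mod N" and ?Z = "z mod N"
  have fgx: "f x z = g ?X ?Z" using fg less.prems .
  have lt: "?X < N" "?Z < N" using N by auto
  have pred: "(m - 1) mod N = m mod N - 1" if "m mod N \<noteq> 0" for m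
  proof -
    have "m = N * (m div N) + (m mod N)" by simp
    then have "m - 1 = N * (m div N) + (m mod N - 1)" using that by linarith
    moreover have "m mod N - 1 < N" using N mod_less_divisor[of N m] by linarith
    ultimately show ?thesis by (metis mod_mult_self4 mod_less)
  qed
  have pred0: "(m - 1) mod N = N - 1" if "m mod N = 0" "0 < m" for m
  proof -
    have "N dvd m" using that(1) by (simp add: mod_eq_0_iff_dvd)
    then obtain q where q: "m = N * q" by (elim dvdE)
    with that(2) have "q \<noteq> 0" by auto
    with q obtain r where "m = N * Suc r" by (cases q) auto
    then have "m - 1 = N * r + (N - 1)" using N by simp
    then have "(m - 1) mod N = (N - 1) mod N" by (metis mod_mult_self4)
    then show ?thesis using N by simp
  qed
  have corner: "\<not> grid f a b" if "a mod N = N - 1" "b mod N = N - 1" "a + b < x + z" for a b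
  proof (cases "N \<le> a \<or> N \<le> b")
    case True
    then show ?thesis using less.hyps[of a b] that corner_g by simp
  next
    case False
    then show ?thesis using that corner_f by simp
  qed
  consider "?X = 0 \<and> ?Z < N - 1 \<or> ?Z = 0 \<and> ?X < N - 1"
    | "?X = 0 \<and> ?Z = N - 1 \<or> ?X = N - 1 \<and> ?Z = 0" | "?X \<noteq> 0" "?Z \<noteq> 0"
    using lt by linarith
  then show ?case
  proof cases
    case 1
    then have "2 \<le> g ?X ?Z" using edge sym by metis
    then show ?thesis using fgx not_grid_if_ge_2[of f x z] not_grid_if_ge_2[of g ?X ?Z] by simp
  next
    \<comment> \<open>With source 1 the cell belongs to the grid iff both neighbours are absent. One
      neighbour is an edge cell with source at least 2, the other (if it exists) is a corner of a
      preceding period.\<close>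
    case 2
    have g: "\<not> grid g 0 (N - 2)" "\<not> grid g (N - 2) 0"
      using edge[of "N - 2"] sym N not_grid_if_ge_2 by force+
    have "grid g 0 (N - 1)" "grid g (N - 1) 0"
      by (subst grid.simps, use N edge_end sym[of 0 "N - 1"] g in \<open>simp add: numeral_2_eq_2\<close>)+
    moreover have "grid f x z"
    proof -
      have left: "\<not> grid f (x - 1) z" if "x \<noteq> 0"
        using 2
      proof
        assume XZ: "?X = 0 \<and> ?Z = N - 1"
        then show ?thesis using that pred0[of x] by (intro corner) auto
      next
        assume XZ: "?X = N - 1 \<and> ?Z = 0"
        then have "N \<le> x - 1 \<or> N \<le> z" using less.prems N by (cases "x = N") auto
        then have "f (x - 1) z = g (N - 2) 0" using fg[of "x - 1" z] pred[of x] XZ N by (simp add: numeral_2_eq_2)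
        then show ?thesis using edge[of "N - 2"] sym N not_grid_if_ge_2[of f "x - 1" z] by simp
      qed
      have below: "\<not> grid f x (z - 1)" if "z \<noteq> 0"
        using 2
      proof
        assume XZ: "?X = 0 \<and> ?Z = N - 1"
        then have "N \<le> x \<or> N \<le> z - 1" using less.prems N by (cases "z = N") auto
        then have "f x (z - 1) = g 0 (N - 2)" using fg[of x "z - 1"] pred[of z] XZ N by (simp add: numeral_2_eq_2)
        then show ?thesis using edge[of "N - 2"] N not_grid_if_ge_2[of f x "z - 1"] by simp
      next
        assume XZ: "?X = N - 1 \<and> ?Z = 0"
        then show ?thesis using that pred0[of z] by (intro corner) auto
      qed
      have "f x z = 1" using 2 fgx edge_end sym[of 0 "N - 1"] by auto
      then show ?thesis using left below by (subst grid.simps) auto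
    qed
    ultimately show ?thesis using 2 by auto
  next
    case 3
    \<comment> \<open>A step back enters the initial block only from \<open>x = N\<close> or
      \<open>z = N\<close>, so both neighbours stay within reach of the induction
      hypothesis.\<close>
    then have "x \<noteq> N" "z \<noteq> N" by auto
    then have "N \<le> x - 1 \<or> N \<le> z" "N \<le> x \<or> N \<le> z - 1"
      using less.prems by auto
    moreover have "x \<noteq> 0" "z \<noteq> 0" using 3 by (metis mod_0)+
    ultimately show ?thesis
      using less.hyps[of "x - 1" z] less.hyps[of x "z - 1"] 3 fgx pred[of x] pred[of z]
      by (simp add: grid.simps[of f x z] grid.simps[of g ?X ?Z])
  qed
qed

section \<open>Counting inner splits\<close>

definition all_splits :: "nat \<Rightarrow> nat \<Rightarrow> nat \<Rightarrow> nat set" where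
  "all_splits y x z = {i. i \<le> y \<and> i AND x = 0 \<and> (y - i) AND z = 0}"

lemma finite_all_splits [simp]: "finite (all_splits y x z)"
  unfolding all_splits_def by (rule finite_subset[of _ "{..y}"]) auto

text \<open>Equal halves force \<open>i = z\<close> and \<open>x = y - z\<close>, so at most one
  split is lost; \<open>x AND z = 0\<close> says that this split was present.\<close>

lemma inner_splits_eq:
  "inner_splits y x z = (if x + z = y \<and> x AND z = 0 then all_splits y x z - {z} else all_splits y x z)"
  by (auto simp: inner_splits_def all_splits_def and.commute)

text \<open>Reversing the word sends \<open>i\<close> to \<open>y - i\<close>.\<close>

lemma card_all_splits_commute: "card (all_splits y x z) = card (all_splits y z x)"
  by (rule bij_betw_same_card[of "\<lambda>i. y - i"], rule bij_betw_byWitness[where f' = "\<lambda>i. y - i"])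
    (auto simp: all_splits_def)

lemma card_inner_splits_commute: "card (inner_splits y x z) = card (inner_splits y z x)"
  by (rule bij_betw_same_card[of "\<lambda>i. y - i"], rule bij_betw_byWitness[where f' = "\<lambda>i. y - i"])
    (auto simp: inner_splits_def)

lemma and_mod_exp_nat:
  fixes i x :: nat
  assumes "i < 2 ^ n"
  shows "i AND (x mod 2 ^ n) = i AND x"
proof -
  have "take_bit n i = i" using assms by (rule take_bit_nat_eq_self)
  then have "bit i m \<Longrightarrow> m < n" for m by (metis bit_take_bit_iff)
  then show ?thesis
    unfolding take_bit_eq_mod[symmetric] by (auto simp: bit_eq_iff bit_simps)
qed

text \<open>Both \<open>i\<close> and \<open>y - i\<close> have bits only below position
  \<open>n\<close>, so higher bits of \<open>x\<close> and \<open>z\<close> are never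
  tested.\<close>

lemma all_splits_mod:
  assumes "y < 2 ^ n"
  shows "all_splits y (x mod 2 ^ n) (z mod 2 ^ n) = all_splits y x z"
proof -
  have "i AND (x mod 2 ^ n) = i AND x" "(y - i) AND (z mod 2 ^ n) = (y - i) AND z" if "i \<le> y" for i
    using that assms by (auto intro!: and_mod_exp_nat)
  then show ?thesis unfolding all_splits_def by auto
qed

lemma and_mask_nat:
  fixes i :: nat
  assumes "i < 2 ^ n"
  shows "i AND (2 ^ n - 1) = i"
  using assms take_bit_nat_eq_self[OF assms] by (simp add: take_bit_eq_mask mask_eq_exp_minus_1)

text \<open>Some bit \<open>q <= k\<close> of \<open>z\<close> is 0, so \<open>y - i\<close> may be
  0 or \<open>2 ^ q\<close>.\<close>

lemma card_all_splits_edge: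
  assumes "2 ^ k \<le> y" and "z < 2 ^ (k + 1) - 1"
  shows "2 \<le> card (all_splits y 0 z)"
proof -
  have "\<exists>q < k + 1. \<not> bit z q"
  proof (rule ccontr)
    assume "\<not> (\<exists>q < k + 1. \<not> bit z q)"
    then have "take_bit (k + 1) z = mask (k + 1)" by (auto simp: bit_eq_iff bit_simps)
    moreover have "take_bit (k + 1) z = z" using assms by (intro take_bit_nat_eq_self) simp
    ultimately show False using assms by (simp add: mask_eq_exp_minus_1)
  qed
  then obtain q where q: "q < k + 1" "\<not> bit z q" by blast
  have "(2 :: nat) ^ q \<le> 2 ^ k" using q by (intro power_increasing) auto
  then have le: "2 ^ q \<le> y" using assms(1) by (rule le_trans)
  then have "{y, y - 2 ^ q} \<subseteq> all_splits y 0 z"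
    using q and_exp_eq_0_iff_not_bit[of z q] by (auto simp: all_splits_def and.commute)
  moreover have "y \<noteq> y - 2 ^ q"
    using le by (metis diff_diff_cancel diff_self_eq_0 power_not_zero zero_neq_numeral)
  ultimately show ?thesis
    using card_mono[of "all_splits y 0 z" "{y, y - 2 ^ q}"] by simp
qed

lemma all_splits_edge_end:
  assumes "y < 2 ^ n"
  shows "all_splits y 0 (2 ^ n - 1) = {y}"
proof -
  have "(y - i) AND (2 ^ n - 1) = y - i" for i using assms by (intro and_mask_nat) simp
  then show ?thesis by (auto simp: all_splits_def)
qed

lemma all_splits_corner:
  assumes "y < 2 ^ n" "0 < y"
  shows "all_splits y (2 ^ n - 1) (2 ^ n - 1) = {}"
proof -
  have "(y - i) AND (2 ^ n - 1) = y - i" "i \<le> y \<Longrightarrow> i AND (2 ^ n - 1) = i" for i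
    by (rule and_mask_nat, use assms in simp)+
  then show ?thesis using assms by (auto simp: all_splits_def)
qed

text \<open>
  The bits of \<open>e\<close> are missing from \<open>y\<close>; the remaining part \<open>y - e\<close> is split along \<open>z\<close>,
  and \<open>e\<close> is added to the first half.
\<close>

lemma shifted_split:
  fixes x y z e :: nat
  assumes xz: "x + z = y" "x AND z = 0" and e: "e \<le> y" "y AND e = 0"
  defines "i \<equiv> e + ((y - e) AND z)"
  shows "i \<in> all_splits y x z" and "e = i XOR (i AND z)"
proof -
  have y: "y = x OR z" using xz disjunctive_add_eq_or by metis
  have ex: "bit e n \<Longrightarrow> \<not> bit x n" and ez: "bit e n \<Longrightarrow> \<not> bit z n" and xzn: "bit x n \<Longrightarrow> \<not> bit z n" for n
    using e(2) xz(2) unfolding y by (auto simp: bit_eq_iff bit_simps)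
  define d where "d = y - e"
  \<comment> \<open>The bits of \<open>d\<close> outside \<open>z\<close>; \<open>j\<close> turns
    out to be the second part \<open>y - i\<close>.\<close>
  define j where "j = d XOR (d AND z)"
  have "(d AND z) AND j = 0" "(d AND z) OR j = d" by (auto simp: j_def bit_eq_iff bit_simps)
  then have d: "(d AND z) + j = d" using disjunctive_add_eq_or by metis
  have "e AND (d AND z) = 0" using ez by (auto simp: bit_eq_iff bit_simps)
  then have i: "i = e OR (d AND z)" unfolding i_def d_def by (rule disjunctive_add_eq_or)
  have "y = i + j" using d e(1) unfolding i_def d_def by simp
  moreover have "i AND x = 0" using ex xzn unfolding i by (auto simp: bit_eq_iff bit_simps)
  moreover have "j AND z = 0" by (auto simp: j_def bit_eq_iff bit_simps)
  ultimately show "i \<in> all_splits y x z" by (simp add: all_splits_def)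
  \<comment> \<open>Bits of \<open>e\<close> avoid \<open>z\<close>, and all other bits of
    \<open>i\<close> lie in \<open>z\<close>, so deleting the bits of \<open>z\<close> recovers
    \<open>e\<close>.\<close>
  show "e = i XOR (i AND z)" using ez unfolding i by (auto simp: bit_eq_iff bit_simps)
qed

definition zero_positions :: "nat \<Rightarrow> nat set" where
  "zero_positions y = {i. 2 ^ i \<le> y \<and> \<not> bit y i}"

lemma finite_zero_positions: "finite (zero_positions y)"
proof (rule finite_subset)
  show "zero_positions y \<subseteq> {..y}"
    by (auto simp: zero_positions_def intro: less_imp_le less_le_trans[OF less_exp])
qed simp

text \<open>Two zero positions \<open>p\<close>, \<open>q\<close> give the shifts 0,
  \<open>2 ^ p\<close> and \<open>2 ^ q\<close>; each can be decoded from its split, so the splits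
  are distinct.\<close>

lemma not_zumkeller_card_all_splits:
  assumes "\<not> zumkeller y" "0 < y" "x + z = y" "x AND z = 0"
  shows "3 \<le> card (all_splits y x z)"
proof -
  have "\<not> card (zero_positions y) \<le> Suc 0"
    using assms by (simp add: zumkeller_def zero_positions_def)
  then obtain p q where pq: "p \<in> zero_positions y" "q \<in> zero_positions y" "p \<noteq> q"
    using card_le_Suc0_iff_eq[OF finite_zero_positions] by blast
  define E where "E = {0, 2 ^ p, 2 ^ q :: nat}"
  have E: "e \<le> y" "y AND e = 0" if "e \<in> E" for e
    using that pq by (auto simp: E_def zero_positions_def and_exp_eq_0_iff_not_bit)
  define h where "h e = e + ((y - e) AND z)" for e
  have "inj_on h E"
  proof (rule inj_on_inverseI)
    show "h e XOR (h e AND z) = e" if "e \<in> E" for e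
      using shifted_split(2)[of x z y e] assms(3,4) E[OF that] by (simp add: h_def)
  qed
  moreover have "h ` E \<subseteq> all_splits y x z"
    using shifted_split(1)[OF assms(3,4)] E by (auto simp: h_def)
  moreover have "card E = 3" using pq(3) by (simp add: E_def)
  ultimately show ?thesis by (metis card_inj_on_le finite_all_splits)
qed

text \<open>Each split corresponds to a nonzero \<open>j = y - i\<close> whose bits all lie in zero
  positions of \<open>y\<close>. With at most one such position there is at most one
  \<open>j\<close>.\<close>

lemma zumkeller_card_inner_splits:
  assumes "zumkeller y"
  shows "card (inner_splits y 0 y) \<le> 1"
proof -
  have one: "p = q" if "p \<in> zero_positions y" "q \<in> zero_positions y" for p q
    using that assms card_le_Suc0_iff_eq[OF finite_zero_positions, of y]
    by (auto simp: zumkeller_def zero_positions_def)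
  have bits: "n \<in> zero_positions y" if "j \<le> y" "j AND y = 0" "bit j n" for j n
  proof -
    have "j div 2 ^ n \<noteq> 0" using that(3) by (auto simp: bit_nat_def intro: ccontr)
    then have "2 ^ n \<le> j" by (meson div_less not_le)
    moreover have "\<not> bit y n" using that(2,3) by (metis bit_0_eq bit_and_iff bot_apply bot_bool_def)
    ultimately show ?thesis using that(1) by (simp add: zero_positions_def)
  qed
  have nz: "\<exists>n. bit j n" if "j \<noteq> 0" for j :: nat
    using that by (auto simp: bit_eq_iff)
  have eq: "j = l" if "j \<le> y" "j AND y = 0" "j \<noteq> 0" "l \<le> y" "l AND y = 0" "l \<noteq> 0" for j l
    using bits[OF that(1,2)] bits[OF that(4,5)] nz[OF that(3)] nz[OF that(6)] one
    by (intro bit_eqI) metis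
  have "i = i'" if "i \<in> inner_splits y 0 y" "i' \<in> inner_splits y 0 y" for i i'
    using that eq[of "y - i" "y - i'"] by (auto simp: inner_splits_def)
  then show ?thesis using card_le_Suc0_iff_eq[of "inner_splits y 0 y"] by simp
qed

section \<open>Periodicity and impurities\<close>

theorem theorem1p7:
  fixes y k :: nat
  assumes "1 \<le> y"
    and "2 ^ k \<le> y" and "y < 2 ^ (k + 1)"
  shows "(biperiodic (Ulam y) \<longleftrightarrow> \<not> zumkeller y)
       \<and> (\<not> zumkeller y \<longrightarrow> has_biperiod (Ulam y) (2 ^ (k + 1)) (2 ^ (k + 1)))
       \<and> (zumkeller y \<longrightarrow>
            (\<exists>P. has_biperiod P (2 ^ (k + 1)) (2 ^ (k + 1)) \<and>
                 (\<forall>x z. ((x, z) \<in> Ulam y) \<noteq> ((x, z) \<in> P) \<longrightarrow>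
                        x < 2 ^ (k + 1) \<and> z < 2 ^ (k + 1))))"
proof -
  define N :: nat where "N = 2 ^ (k + 1)"
  define S T where "S x z = card (inner_splits y x z)" and "T x z = card (all_splits y x z)" for x z
  have N2: "2 \<le> N" and yN: "y < N" using assms by (simp_all add: N_def)
  have Ulam_iff: "(x, z) \<in> Ulam y \<longleftrightarrow> grid S x z" for x z
    using is_Ulam_two_word[of y x z] by (simp add: Ulam_def two_word_def S_def[abs_def])
  have sym: "T x z = T z x" "S x z = S z x" for x z
    unfolding S_def T_def by (rule card_all_splits_commute card_inner_splits_commute)+
  have T_mod: "T (x mod N) (z mod N) = T x z" for x z
    unfolding T_def N_def using all_splits_mod[of y "k + 1"] assms(3) by simp
  have S_eq_T: "S x z = T x z" if "x + z \<noteq> y" for x z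
    using that by (simp add: S_def T_def inner_splits_eq)
  have edge: "2 \<le> T 0 z" if "z < N - 1" for z
    using card_all_splits_edge[of k y z] that assms(2) by (simp add: T_def N_def)
  have edge_end: "T 0 (N - 1) = 1"
    using all_splits_edge_end[of y "k + 1"] assms(3) by (simp add: T_def N_def)
  have T_corner: "T (N - 1) (N - 1) = 0"
    using all_splits_corner[of y "k + 1"] assms by (simp add: T_def N_def)
  have S_corner: "S (N - 1) (N - 1) = 0"
    using T_corner S_eq_T[of "N - 1" "N - 1"] yN N2 assms(1)
    by (metis card_0_eq finite_all_splits inner_splits_eq S_def T_def card.empty empty_Diff)
  have outside: "N \<le> x \<or> N \<le> z \<Longrightarrow> grid S x z = grid T (x mod N) (z mod N)" for x z
  proof (rule grid_mod[OF N2])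
    show "S x z = T (x mod N) (z mod N)" if "N \<le> x \<or> N \<le> z" for x z
      using that yN S_eq_T[of x z] by (auto simp: T_mod)
  qed (use not_grid_diagonal S_corner T_corner sym edge edge_end in auto)
  \<comment> \<open>The first block of \<open>grid T\<close>, repeated in both directions.\<close>
  define P where "P = {(x, z). grid T (x mod N) (z mod N)}"
  have P_biperiod: "has_biperiod P N N"
    using N2 by (simp add: has_biperiod_def P_def)
  have outside_P: "(x, z) \<in> Ulam y \<longleftrightarrow> (x, z) \<in> P" if "N \<le> x \<or> N \<le> z" for x z
    using outside[OF that] by (simp add: Ulam_iff P_def)
  have pure: "Ulam y = P" if "\<not> zumkeller y"
  proof -
    have "S x z = T x z \<or> 2 \<le> S x z \<and> 2 \<le> T x z" for x z
    proof (cases "x + z = y \<and> x AND z = 0")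
      case True
      then have "3 \<le> T x z" using not_zumkeller_card_all_splits[OF that] assms(1) by (simp add: T_def)
      moreover have "T x z \<le> S x z + 1"
        using True card_Diff1_le[of "all_splits y x z" z] card_Diff_singleton_if[of "all_splits y x z" z]
        by (simp add: S_def T_def inner_splits_eq split: if_splits)
      ultimately show ?thesis by simp
    next
      case False
      then show ?thesis by (auto simp: S_def T_def inner_splits_eq)
    qed
    then have "grid S x z = grid T x z" for x z by (rule grid_cong)
    then have "(x, z) \<in> Ulam y \<longleftrightarrow> (x, z) \<in> P" for x z
      using outside_P[of x z] by (cases "N \<le> x \<or> N \<le> z") (auto simp: Ulam_iff P_def)
    then show ?thesis by auto
  qed
  have impure: "\<not> biperiodic (Ulam y)" if "zumkeller y"
  proof
    assume "biperiodic (Ulam y)"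
    then obtain p q where pq: "has_biperiod (Ulam y) p q" by (auto simp: biperiodic_def)
    have shift: "(x, z) \<in> Ulam y \<longleftrightarrow> (x + m * p, z) \<in> Ulam y" for x z m
    proof (induction m)
      case (Suc m)
      moreover have "(x + m * p, z) \<in> Ulam y \<longleftrightarrow> (x + m * p + p, z) \<in> Ulam y"
        using pq unfolding has_biperiod_def by blast
      ultimately show ?case by (simp add: ac_simps)
    qed simp
    \<comment> \<open>The shift \<open>N * p\<close> is a multiple of the assumed period, vanishes
      modulo \<open>N\<close>, and leaves the initial block, where \<open>Ulam y\<close> could
      differ from \<open>P\<close>.\<close>
    have "(0, y) \<in> Ulam y \<longleftrightarrow> (0 + N * p, y) \<in> Ulam y" by (rule shift)
    also have "\<dots> \<longleftrightarrow> (0 + N * p, y) \<in> P"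
      using pq by (intro outside_P) (simp add: has_biperiod_def)
    also have "\<dots> \<longleftrightarrow> grid T 0 y" using yN by (simp add: P_def)
    finally have same: "grid S 0 y = grid T 0 y" by (simp add: Ulam_iff)
    \<comment> \<open>The only neighbour of \<open>(0, y)\<close> is absent from both grids, so the
      source alone decides there.\<close>
    have "2 \<le> T 0 (y - 1)" using yN assms(1) by (intro edge) simp
    moreover from this have "2 \<le> S 0 (y - 1)" using S_eq_T[of 0 "y - 1"] assms(1) by simp
    ultimately have "\<not> grid T 0 (y - 1)" "\<not> grid S 0 (y - 1)"
      using not_grid_if_ge_2 by blast+
    then have "grid T 0 y \<longleftrightarrow> T 0 y = 1" "grid S 0 y \<longleftrightarrow> S 0 y = 1"
      by (subst grid.simps, simp)+
    moreover have "T 0 y = S 0 y + 1"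
    proof -
      have "y \<in> all_splits y 0 y" by (simp add: all_splits_def)
      then show ?thesis
        using card_Suc_Diff1[OF finite_all_splits] by (simp add: S_def T_def inner_splits_eq)
    qed
    \<comment> \<open>Hence \<open>S\<close> and \<open>T\<close> take the values 0 and 1, or 1 and
      2, at \<open>(0, y)\<close>: exactly one of them is 1.\<close>
    moreover have "S 0 y \<le> 1" using zumkeller_card_inner_splits[OF that] by (simp add: S_def)
    ultimately show False using same by auto
  qed
  have "biperiodic (Ulam y)" if "\<not> zumkeller y"
    using pure[OF that] P_biperiod by (auto simp: biperiodic_def)
  moreover have "\<exists>P. has_biperiod P N N \<and>
      (\<forall>x z. ((x, z) \<in> Ulam y) \<noteq> ((x, z) \<in> P) \<longrightarrow> x < N \<and> z < N)"
    using P_biperiod outside_P by (intro exI[of _ P]) (meson not_le)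
  ultimately show ?thesis
    using pure impure P_biperiod unfolding N_def by auto
qed

end
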